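(* Let $\mathit{Var}$ be finite, $M$ a commutative complete quantale. For every $\sigma:\mathit{Var}\to M_1$ (whether or not the $\sigma(v)$ are $\otimes$-idempotent), $\alpha_\sigma=\alpha^{\mathbb N}_\sigma\circ s$ as maps $\mathcal U(\mathit{Var})\to M$.
   Context: A commutative complete quantale $\langle M,\sqsubseteq,\bigvee,\otimes,1\rangle$ is a complete lattice with a commutative monoid $(\otimes,1)$ such that $\otimes$ distributes over arbitrary joins. $M_1=\{m\mid 1\sqsubseteq m\}$. $m^0=1$ and $m^n$ is the $n$-fold tensor power; empty tensors are $1$. $\mathcal U_{\mathbb N}(\mathit{Var})$ is the set of downsets of $(\mathbb N^{\mathit{Var}},\le)$ and $\mathcal U(\mathit{Var})$ is the set of downsets of $(\mathcal P(\mathit{Var}),\subseteq)$, both ordered by inclusion. $\alpha^{\mathbb N}_\sigma:\mathcal U_{\mathbb N}\to M$ is $\alpha^{\mathbb N}_\sigma(\mathbb M)=\bigvee_{m\in\mathbb M}\bigotimes_v\sigma(v)^{m(v)}$; $\alpha_\sigma:\mathcal U\to M$ is $\alpha_\sigma(\mathbb X)=\bigvee_{X\in\mathbb X}\bigotimes_{v\in X}\sigma(v)$; and $s:\mathcal U\to\mathcal U_{\mathbb N}$ is $s(\mathbb X)={\downarrow}\{\chi_X\mid X\in\mathbb X\}$, where $\chi_X\in\mathbb N^{\mathit{Var}}$ is the characteristic function of $X$. *)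

theory Defs
  imports Main "HOL-Library.FuncSet" "HOL-Library.Indicator_Function"
begin

text \<open>The tensor, its unit and its powers are \<open>*\<close>, \<open>1\<close> and \<open>^\<close>; \<open>\<sqsubseteq>\<close> is \<open>\<le>\<close>.\<close>

class comm_quantale = complete_lattice + comm_monoid_mult +
  assumes mult_Sup_distrib: "a * Sup B = (SUP b\<in>B. a * b)"

definition M1 :: "'m::comm_quantale set" where
  "M1 = {m. 1 \<le> m}"

definition downsets :: "'a::order set \<Rightarrow> 'a set set" where
  "downsets A = {D. D \<subseteq> A \<and> (\<forall>x\<in>D. \<forall>y\<in>A. y \<le> x \<longrightarrow> y \<in> D)}"

definition down_closure :: "'a::order set \<Rightarrow> 'a set \<Rightarrow> 'a set" where
  "down_closure A S = {x\<in>A. \<exists>y\<in>S. x \<le> y}"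

text \<open>The variables form a set \<open>Var\<close> rather than a whole type, so that \<open>Var\<close> may be empty.
  Exponent functions are extensional: they all take the value \<open>undefined\<close> outside \<open>Var\<close>, so the
  order on the function type restricts to the pointwise order over \<open>Var\<close>.\<close>

definition exponents :: "'v set \<Rightarrow> ('v \<Rightarrow> nat) set" where
  "exponents Var = Var \<rightarrow>\<^sub>E UNIV"

definition U_N :: "'v set \<Rightarrow> ('v \<Rightarrow> nat) set set" where
  "U_N Var = downsets (exponents Var)"

definition U :: "'v set \<Rightarrow> 'v set set set" where
  "U Var = downsets (Pow Var)"

definition alphaN :: "'v set \<Rightarrow> ('v \<Rightarrow> 'm::comm_quantale) \<Rightarrow> ('v \<Rightarrow> nat) set \<Rightarrow> 'm" where
  "alphaN Var \<sigma> \<M> = (SUP m\<in>\<M>. \<Prod>v\<in>Var. \<sigma> v ^ m v)"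

text \<open>No \<open>Var\<close> argument is needed here: the products range over the members of \<open>\<X>\<close>.\<close>

definition alpha :: "('v \<Rightarrow> 'm::comm_quantale) \<Rightarrow> 'v set set \<Rightarrow> 'm" where
  "alpha \<sigma> \<X> = (SUP X\<in>\<X>. \<Prod>v\<in>X. \<sigma> v)"

definition chi :: "'v set \<Rightarrow> 'v set \<Rightarrow> 'v \<Rightarrow> nat" where
  "chi Var X = restrict (indicator X) Var"

definition s_map :: "'v set \<Rightarrow> 'v set set \<Rightarrow> ('v \<Rightarrow> nat) set" where
  "s_map Var \<X> = down_closure (exponents Var) (chi Var ` \<X>)"

lemma exponents_le_iff:
  assumes "m \<in> exponents Var" "m' \<in> exponents Var"
  shows "m \<le> m' \<longleftrightarrow> (\<forall>v\<in>Var. m v \<le> m' v)"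
proof
  assume "\<forall>v\<in>Var. m v \<le> m' v"
  moreover have "m v = m' v" if "v \<notin> Var" for v
    using assms that by (simp add: exponents_def PiE_def extensional_def)
  ultimately show "m \<le> m'"
    by (metis le_funI order_refl)
qed (simp add: le_fun_def)

lemma s_map_in_U_N: "s_map Var \<X> \<in> U_N Var"
  by (auto simp: s_map_def U_N_def downsets_def down_closure_def intro: order_trans)

end

theory Submission
  imports Defs
begin

text \<open>Since every \<open>\<sigma> v\<close> lies above \<open>1\<close>, the monomial \<open>\<Prod>v\<in>Var. \<sigma> v ^ m v\<close> is monotone in
  the exponent \<open>m\<close>. Hence passing to the down closure does not change the join, and the monomial of
  the characteristic function of \<open>X\<close> is \<open>\<Prod>v\<in>X. \<sigma> v\<close>.\<close>

text \<open>Order is encoded by joins: \<open>a \<le> b\<close> says that \<open>b\<close> is the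
  join of \<open>{a, b}\<close>, and \<otimes> distributes over this join.\<close>

lemma quantale_mult_left_mono:
  fixes a b c :: "'m::comm_quantale"
  assumes "a \<le> b"
  shows "c * a \<le> c * b"
proof -
  have "c * b = c * Sup {a, b}"
    using assms by (simp add: sup_absorb2)
  also have "\<dots> = sup (c * a) (c * b)"
    \<comment> \<open>Distributing first keeps \<open>Sup {a, b}\<close> from being simplified to a
      binary \<open>sup\<close>, to which the axiom does not apply.\<close>
    by (simp only: mult_Sup_distrib) simp
  finally show ?thesis
    by (metis sup_ge1)
qed

lemma quantale_mult_mono:
  fixes a b c d :: "'m::comm_quantale"
  assumes "a \<le> b" "c \<le> d"
  shows "a * c \<le> b * d"
  by (metis assms quantale_mult_left_mono mult.commute order_trans)

lemma quantale_prod_mono: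
  fixes f g :: "'a \<Rightarrow> 'm::comm_quantale"
  assumes "\<And>i. i \<in> A \<Longrightarrow> f i \<le> g i"
  shows "prod f A \<le> prod g A"
  \<comment> \<open>For infinite \<open>A\<close> both products take the default value 1.\<close>
  using assms by (induction A rule: infinite_finite_induct) (auto intro: quantale_mult_mono)

lemma quantale_power_increasing:
  fixes x :: "'m::comm_quantale"
  assumes "1 \<le> x" "i \<le> j"
  shows "x ^ i \<le> x ^ j"
  using assms(2)
proof (induction j rule: dec_induct)
  case (step n)
  \<comment> \<open>The factor 1 is written out so that \<open>1 \<le> x\<close> can be multiplied
    with reflexivity at \<open>x ^ n\<close>.\<close>
  have "1 * x ^ n \<le> x * x ^ n"
    using assms(1) by (intro quantale_mult_mono) auto
  with step.IH show ?case by simp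
qed simp

lemma prod_power_chi:
  fixes \<sigma> :: "'v \<Rightarrow> 'm::comm_monoid_mult"
  assumes "finite Var" "X \<subseteq> Var"
  shows "(\<Prod>v\<in>Var. \<sigma> v ^ chi Var X v) = (\<Prod>v\<in>X. \<sigma> v)"
\<comment> \<open>Exponent 0 makes every factor outside \<open>X\<close> the unit, so the product
  over \<open>Var\<close> shrinks to \<open>X\<close>, where each exponent is 1.\<close>
proof (rule prod.mono_neutral_cong_right)
  show "\<forall>v\<in>Var - X. \<sigma> v ^ chi Var X v = 1"
    by (simp add: chi_def)
  show "\<sigma> v ^ chi Var X v = \<sigma> v" if "v \<in> X" for v
    using that assms(2) by (simp add: chi_def subset_iff)
qed (use assms in auto)

lemma alphaN_down_closure:
  fixes \<sigma> :: "'v \<Rightarrow> 'm::comm_quantale"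
  assumes "\<sigma> \<in> Var \<rightarrow> M1" "S \<subseteq> exponents Var"
  shows "alphaN Var \<sigma> (down_closure (exponents Var) S) = alphaN Var \<sigma> S"
proof (rule antisym)
  show "alphaN Var \<sigma> (down_closure (exponents Var) S) \<le> alphaN Var \<sigma> S"
    unfolding alphaN_def
  proof (rule SUP_mono)
    fix m assume "m \<in> down_closure (exponents Var) S"
    then obtain n where "n \<in> S" "m \<le> n"
      by (auto simp: down_closure_def)
    moreover have "(\<Prod>v\<in>Var. \<sigma> v ^ m v) \<le> (\<Prod>v\<in>Var. \<sigma> v ^ n v)"
      using assms(1) \<open>m \<le> n\<close>
      by (intro quantale_prod_mono quantale_power_increasing) (auto simp: M1_def le_fun_def)
    ultimately show "\<exists>n\<in>S. (\<Prod>v\<in>Var. \<sigma> v ^ m v) \<le> (\<Prod>v\<in>Var. \<sigma> v ^ n v)"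
      by blast
  qed
  \<comment> \<open>By reflexivity \<open>S\<close> lies in its own down closure, which is cut down
    to \<open>exponents Var\<close>; hence the assumption on \<open>S\<close>.\<close>
  show "alphaN Var \<sigma> S \<le> alphaN Var \<sigma> (down_closure (exponents Var) S)"
    unfolding alphaN_def
    by (rule SUP_subset_mono) (use assms(2) in \<open>auto simp: down_closure_def\<close>)
qed

theorem proposition4:
  fixes Var :: "'v set" and \<sigma> :: "'v \<Rightarrow> 'm::comm_quantale"
  assumes "finite Var" and "\<sigma> \<in> Var \<rightarrow> M1"
  shows "\<forall>\<X>\<in>U Var. alpha \<sigma> \<X> = (alphaN Var \<sigma> \<circ> s_map Var) \<X>"
proof
  fix \<X> assume "\<X> \<in> U Var"
  then have sub: "X \<subseteq> Var" if "X \<in> \<X>" for X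
    using that by (auto simp: U_def downsets_def)
  have "chi Var ` \<X> \<subseteq> exponents Var"
    by (auto simp: chi_def exponents_def)
  then have "alphaN Var \<sigma> (s_map Var \<X>) = alphaN Var \<sigma> (chi Var ` \<X>)"
    unfolding s_map_def by (rule alphaN_down_closure[OF assms(2)])
  \<comment> \<open>The two joins agree term by term over \<open>\<X>\<close>; \<open>sub\<close>
    supplies the inclusion that \<open>prod_power_chi\<close> asks for.\<close>
  also have "\<dots> = alpha \<sigma> \<X>"
    by (simp add: alphaN_def alpha_def image_image prod_power_chi assms(1) sub)
  finally show "alpha \<sigma> \<X> = (alphaN Var \<sigma> \<circ> s_map Var) \<X>"
    by simp
qed

end
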